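(* For any instance of a multiobjective optimization problem and any $\varepsilon>0$, there exists a minimum-cardinality ordinary $(1+\varepsilon)$-approximation set that is quasi-$1$-exact. In particular, the minimum cardinality of an ordinary $(1+\varepsilon)$-approximation set and the minimum cardinality of a quasi-$1$-exact $(1+\varepsilon)$-approximation set coincide for every instance.
   Context: An instance $(X,f)$ of a multiobjective optimization problem consists of a set $X$ of feasible solutions and $f=(f_1,\dots,f_p)$, $f_i:X\to\mathbb{Q}_{>0}$, all to be minimized ($p\ge1$). Standing assumption: there is a positive integer $M$ such that the binary encoding length of $f_i(x)$ is at most $M$ for all $x\in X$ and all $i$. In particular, $f(X)$ is finite. An ordinary $(1+\varepsilon)$-approximation set is a set $P\subseteq X$ such that for every $x'\in X$ there is $x\in P$ with $f_i(x)\le(1+\varepsilon)f_i(x')$ for all $i$. A quasi-$1$-exact $(1+\varepsilon)$-approximation set is a set $P\subseteq X$ such that for every $x'\in X$ there is $x\in P$ with $f_i(x)\le(1+\varepsilon)f_i(x')$ for all $i$ and $f_j(x)\le f_j(x')$ for at least one $j$ (possibly depending on $x,x'$). Minimum cardinality is taken over all approximation sets of the respective type for the given instance and given $\varepsilon$. *)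

theory Defs
  imports Complex_Main "HOL-Library.Log_Nat" "HOL-Library.Equipollence"
begin

text \<open>Binary encoding length of a rational: one sign bit plus the numbers of binary digits of
  numerator and denominator in lowest terms.\<close>

definition rat_encoding_length :: "rat \<Rightarrow> int" where
  "rat_encoding_length q =
     (case quotient_of q of (a, b) \<Rightarrow> 1 + bitlen \<bar>a\<bar> + bitlen b)"

text \<open>The objective functions are \<open>f 1, \<dots>, f p\<close>; the values of \<open>f\<close> at other indices
  and outside \<open>X\<close> are irrelevant.\<close>

definition mo_instance :: "'a set \<Rightarrow> nat \<Rightarrow> (nat \<Rightarrow> 'a \<Rightarrow> rat) \<Rightarrow> bool" where
  "mo_instance X p f \<longleftrightarrow>
     1 \<le> p \<and>
     (\<forall>i\<in>{1..p}. \<forall>x\<in>X. 0 < f i x) \<and>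
     (\<exists>M>0. \<forall>i\<in>{1..p}. \<forall>x\<in>X. rat_encoding_length (f i x) \<le> M)"

definition approximates ::
    "nat \<Rightarrow> (nat \<Rightarrow> 'a \<Rightarrow> rat) \<Rightarrow> real \<Rightarrow> 'a \<Rightarrow> 'a \<Rightarrow> bool" where
  "approximates p f \<epsilon> x x' \<longleftrightarrow>
     (\<forall>i\<in>{1..p}. real_of_rat (f i x) \<le> (1 + \<epsilon>) * real_of_rat (f i x'))"

definition approximation_set ::
    "'a set \<Rightarrow> nat \<Rightarrow> (nat \<Rightarrow> 'a \<Rightarrow> rat) \<Rightarrow> real \<Rightarrow> 'a set \<Rightarrow> bool" where
  "approximation_set X p f \<epsilon> P \<longleftrightarrow>
     P \<subseteq> X \<and> (\<forall>x'\<in>X. \<exists>x\<in>P. approximates p f \<epsilon> x x')"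

definition quasi_1_exact_approximation_set ::
    "'a set \<Rightarrow> nat \<Rightarrow> (nat \<Rightarrow> 'a \<Rightarrow> rat) \<Rightarrow> real \<Rightarrow> 'a set \<Rightarrow> bool" where
  "quasi_1_exact_approximation_set X p f \<epsilon> P \<longleftrightarrow>
     P \<subseteq> X \<and>
     (\<forall>x'\<in>X. \<exists>x\<in>P. approximates p f \<epsilon> x x' \<and> (\<exists>j\<in>{1..p}. f j x \<le> f j x'))"

text \<open>Cardinalities are compared by \<open>\<lesssim>\<close> (existence of an injection) because
  \<open>X\<close> may be infinite and \<open>card\<close> is 0 on infinite sets.\<close>

definition minimum_cardinality_set :: "('a set \<Rightarrow> bool) \<Rightarrow> 'a set \<Rightarrow> bool" where
  "minimum_cardinality_set A P \<longleftrightarrow> A P \<and> (\<forall>Q. A Q \<longrightarrow> P \<lesssim> Q)"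

definition has_minimum_cardinality :: "('a set \<Rightarrow> bool) \<Rightarrow> nat \<Rightarrow> bool" where
  "has_minimum_cardinality A n \<longleftrightarrow>
     (\<exists>P. minimum_cardinality_set A P \<and> finite P \<and> card P = n)"

end

(*
  If a minimum-cardinality approximation set P is not quasi-1-exact, some feasible point y is
  strictly better in every objective than an element x of P that approximates it. Replacing x
  by y keeps P a minimum-cardinality approximation set and lowers the sum of the first objective
  over P, a process that terminates because the first objective takes only finitely many values.
*)
theory Submission
  imports Defs
begin

text \<open>A bound on the encoding length bounds the digits of numerator and denominator, so both
  lie in a finite integer interval; \<open>quotient_of\<close> is injective, so only finitely many
  rationals remain.\<close>

lemma finite_rat_encoding_length_le: "finite {q. rat_encoding_length q \<le> M}"
proof -
  define B :: int where "B = 2 ^ nat M"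
  have "quotient_of q \<in> {- B..B} \<times> {- B..B}" if "rat_encoding_length q \<le> M" for q
  proof -
    obtain a b where ab: "quotient_of q = (a, b)" by (cases "quotient_of q")
    have "1 + bitlen \<bar>a\<bar> + bitlen b \<le> M"
      using that ab by (simp add: rat_encoding_length_def)
    moreover have "0 \<le> bitlen \<bar>a\<bar>" "0 \<le> bitlen b"
      by (rule bitlen_nonneg)+
    ultimately have "bitlen \<bar>a\<bar> \<le> M" "bitlen b \<le> M"
      by linarith+
    then have "\<bar>a\<bar> < B" "b < B"
      by (simp_all only: B_def bitlen_le_iff_power)
    moreover have "0 < b" using quotient_of_denom_pos[OF ab] .
    ultimately show ?thesis using ab by auto
  qed
  then have "quotient_of ` {q. rat_encoding_length q \<le> M} \<subseteq> {- B..B} \<times> {- B..B}"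
    by blast
  then have "finite (quotient_of ` {q. rat_encoding_length q \<le> M})"
    by (rule finite_subset) simp
  then show ?thesis
    by (rule finite_imageD) (simp add: inj_on_def quotient_of_inject_eq)
qed

lemma mo_instance_finite_values:
  assumes "mo_instance X p f" "i \<in> {1..p}"
  shows "finite (f i ` X)"
proof -
  obtain M where "\<forall>i\<in>{1..p}. \<forall>x\<in>X. rat_encoding_length (f i x) \<le> M"
    using assms(1) by (auto simp: mo_instance_def)
  then have "f i ` X \<subseteq> {q. rat_encoding_length q \<le> M}"
    using assms(2) by blast
  then show ?thesis
    by (rule finite_subset) (rule finite_rat_encoding_length_le)
qed

lemma approximates_if_le:
  assumes "mo_instance X p f" "\<epsilon> \<ge> 0" "x' \<in> X" "\<forall>i\<in>{1..p}. f i x \<le> f i x'"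
  shows "approximates p f \<epsilon> x x'"
  unfolding approximates_def
proof
  fix i assume i: "i \<in> {1..p}"
  have "0 \<le> real_of_rat (f i x')"
    using assms(1,3) i by (simp add: mo_instance_def less_imp_le)
  then have "1 * real_of_rat (f i x') \<le> (1 + \<epsilon>) * real_of_rat (f i x')"
    using assms(2) by (intro mult_right_mono) auto
  moreover have "real_of_rat (f i x) \<le> real_of_rat (f i x')"
    using assms(4) i by (simp add: of_rat_less_eq)
  ultimately show "real_of_rat (f i x) \<le> (1 + \<epsilon>) * real_of_rat (f i x')"
    by simp
qed

lemma approximates_mono:
  assumes "approximates p f \<epsilon> x z" "\<forall>i\<in>{1..p}. f i y \<le> f i x"
  shows "approximates p f \<epsilon> y z"
  unfolding approximates_def
proof
  fix i assume i: "i \<in> {1..p}"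
  then have "real_of_rat (f i y) \<le> real_of_rat (f i x)"
    using assms(2) by (simp add: of_rat_less_eq)
  also have "\<dots> \<le> (1 + \<epsilon>) * real_of_rat (f i z)"
    using assms(1) i by (simp add: approximates_def)
  finally show "real_of_rat (f i y) \<le> (1 + \<epsilon>) * real_of_rat (f i z)" .
qed

text \<open>\<open>X\<close> may be infinite, but there are only finitely many objective vectors.
  One representative per vector suffices, since points with equal vectors approximate each
  other.\<close>

lemma finite_approximation_set_exists:
  assumes inst: "mo_instance X p f" and "\<epsilon> \<ge> 0"
  obtains P where "approximation_set X p f \<epsilon> P" "finite P"
proof -
  \<comment> \<open>Without \<open>restrict\<close>, the arbitrary values of \<open>f\<close> at
    indices outside \<open>{1..p}\<close> could make the image of \<open>X\<close> infinite.\<close>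
  define h where "h x = restrict (\<lambda>i. f i x) {1..p}" for x
  have "h ` X \<subseteq> (\<Pi>\<^sub>E i\<in>{1..p}. f i ` X)"
    by (auto simp: h_def)
  moreover have "finite (\<Pi>\<^sub>E i\<in>{1..p}. f i ` X)"
    using mo_instance_finite_values[OF inst] by (intro finite_PiE) auto
  ultimately have "finite (h ` X)" by (rule finite_subset)
  then obtain P where P: "P \<subseteq> X" "finite P" "h ` X = h ` P"
    using finite_subset_image[OF \<open>finite (h ` X)\<close> subset_refl] by metis
  have "\<exists>x\<in>P. approximates p f \<epsilon> x x'" if "x' \<in> X" for x'
  proof -
    have "h x' \<in> h ` P"
      using that by (simp add: P(3)[symmetric])
    then obtain x where x: "x \<in> P" "h x' = h x"
      by (elim imageE)
    have "f i x = f i x'" if "i \<in> {1..p}" for i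
      using fun_cong[OF x(2), of i] that by (simp add: h_def)
    then show ?thesis
      using approximates_if_le[OF inst assms(2) \<open>x' \<in> X\<close>, of x] x(1) by auto
  qed
  then have "approximation_set X p f \<epsilon> P"
    using P(1) by (simp add: approximation_set_def)
  then show ?thesis using that P(2) by simp
qed

text \<open>A finite set injects into every infinite one, so only finite competitors matter; the
  guard \<open>finite Q\<close> is there because \<open>card\<close> is 0 on infinite sets.\<close>

lemma minimum_cardinality_set_iff_card_le:
  assumes "finite P"
  shows "minimum_cardinality_set A P \<longleftrightarrow> A P \<and> (\<forall>Q. A Q \<longrightarrow> finite Q \<longrightarrow> card P \<le> card Q)"
proof -
  have "P \<lesssim> Q \<longleftrightarrow> (finite Q \<longrightarrow> card P \<le> card Q)" for Q
    using assms by (cases "finite Q") (simp_all add: finite_lepoll_infinite lepoll_iff_card_le)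
  then show ?thesis by (auto simp: minimum_cardinality_set_def)
qed

lemma finite_minimum_cardinality_set_exists:
  assumes "A P" "finite P"
  obtains Q where "minimum_cardinality_set A Q" "finite Q"
proof -
  obtain Q where "A Q \<and> finite Q" "\<forall>R. A R \<and> finite R \<longrightarrow> card Q \<le> card R"
    using ex_has_least_nat[of "\<lambda>Q. A Q \<and> finite Q" P card] assms by blast
  then show ?thesis
    using that minimum_cardinality_set_iff_card_le by blast
qed

lemma quasi_1_exact_imp_approximation_set:
  "quasi_1_exact_approximation_set X p f \<epsilon> P \<Longrightarrow> approximation_set X p f \<epsilon> P"
  unfolding quasi_1_exact_approximation_set_def approximation_set_def by blast

text \<open>Take \<open>y\<close> where quasi-1-exactness fails and any \<open>x\<close> in
  \<open>P\<close> approximating it: no index has \<open>f j x \<le> f j y\<close>, so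
  \<open>y\<close> beats \<open>x\<close> everywhere. By \<open>approximates_mono\<close>,
  \<open>y\<close> then covers all that \<open>x\<close> covered.\<close>

lemma exchange_if_not_quasi_1_exact:
  assumes "approximation_set X p f \<epsilon> P" "\<not> quasi_1_exact_approximation_set X p f \<epsilon> P"
  obtains x y where "x \<in> P" "y \<in> X" "\<forall>i\<in>{1..p}. f i y < f i x"
    "approximation_set X p f \<epsilon> (insert y (P - {x}))"
proof -
  have sub: "P \<subseteq> X" and cover: "\<And>z. z \<in> X \<Longrightarrow> \<exists>x\<in>P. approximates p f \<epsilon> x z"
    using assms(1) by (auto simp: approximation_set_def)
  then obtain y where y: "y \<in> X"
    and no: "\<And>x j. x \<in> P \<Longrightarrow> approximates p f \<epsilon> x y \<Longrightarrow> j \<in> {1..p} \<Longrightarrow> \<not> f j x \<le> f j y"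
    using assms(2) unfolding quasi_1_exact_approximation_set_def by blast
  obtain x where x: "x \<in> P" "approximates p f \<epsilon> x y"
    using cover[OF y] by blast
  have less: "\<forall>i\<in>{1..p}. f i y < f i x"
    using no[OF x] by (auto simp: not_le)
  then have "approximates p f \<epsilon> y z" if "approximates p f \<epsilon> x z" for z
    using approximates_mono[OF that] by (simp add: less_imp_le)
  then have "\<exists>w\<in>insert y (P - {x}). approximates p f \<epsilon> w z" if "z \<in> X" for z
    using cover[OF that] by blast
  then have "approximation_set X p f \<epsilon> (insert y (P - {x}))"
    using sub y by (auto simp: approximation_set_def)
  then show ?thesis using that x(1) y less by blast
qed

theorem theorem4p4:
  fixes X :: "'a set" and p :: nat and f :: "nat \<Rightarrow> 'a \<Rightarrow> rat" and \<epsilon> :: real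
  assumes "mo_instance X p f" and "\<epsilon> > 0"
  shows "(\<exists>P. minimum_cardinality_set (approximation_set X p f \<epsilon>) P \<and>
              quasi_1_exact_approximation_set X p f \<epsilon> P) \<and>
         (\<exists>n. has_minimum_cardinality (approximation_set X p f \<epsilon>) n \<and>
              has_minimum_cardinality (quasi_1_exact_approximation_set X p f \<epsilon>) n)"
proof -
  let ?A = "approximation_set X p f \<epsilon>" and ?Q = "quasi_1_exact_approximation_set X p f \<epsilon>"
  \<comment> \<open>The rank of \<open>f 1 x\<close> in \<open>f 1 ` X\<close> stands in for \<open>f 1 x\<close>, so that the potential
    is a natural number.\<close>
  define g where "g x = card {v \<in> f 1 ` X. v < f 1 x}" for x
  have one: "1 \<in> {1..p}"
    using assms(1) by (simp add: mo_instance_def)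
  have g_less: "g y < g x" if "y \<in> X" "f 1 y < f 1 x" for x y
    unfolding g_def
  proof (rule psubset_card_mono)
    show "finite {v \<in> f 1 ` X. v < f 1 x}"
      using mo_instance_finite_values[OF assms(1) one] by simp
    show "{v \<in> f 1 ` X. v < f 1 y} \<subset> {v \<in> f 1 ` X. v < f 1 x}"
      \<comment> \<open>Strictness is witnessed by \<open>f 1 y\<close> itself, which is a value on
        \<open>X\<close> because \<open>y\<close> is feasible.\<close>
      using that by force
  qed
  obtain P0 where P0: "?A P0" "finite P0"
    using finite_approximation_set_exists[OF assms(1), of \<epsilon>] assms(2) by auto
  obtain P1 where P1: "minimum_cardinality_set ?A P1" "finite P1"
    using finite_minimum_cardinality_set_exists[of ?A, OF P0] .
  \<comment> \<open>Instead of iterating the exchange, choose a minimizer of the potential; a single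
    exchange then gives a contradiction.\<close>
  obtain P where P: "minimum_cardinality_set ?A P" "finite P"
    and least: "\<And>R. minimum_cardinality_set ?A R \<Longrightarrow> finite R \<Longrightarrow> sum g P \<le> sum g R"
    using ex_has_least_nat[of "\<lambda>R. minimum_cardinality_set ?A R \<and> finite R" P1 "sum g"] P1
    by blast
  have AP: "?A P" and card_le: "\<And>R. ?A R \<Longrightarrow> finite R \<Longrightarrow> card P \<le> card R"
    using P by (auto simp: minimum_cardinality_set_iff_card_le)
  have QP: "?Q P"
  proof (rule ccontr)
    assume "\<not> ?Q P"
    then obtain x y where xy: "x \<in> P" "y \<in> X" "\<forall>i\<in>{1..p}. f i y < f i x"
      and AR: "?A (insert y (P - {x}))"
      using exchange_if_not_quasi_1_exact[OF AP] by metis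
    let ?R = "insert y (P - {x})"
    have fin: "finite ?R" using P(2) by simp
    \<comment> \<open>Only an inequality is claimed here and for the sum below, as \<open>y\<close>
      may already belong to \<open>P - {x}\<close>.\<close>
    have "card ?R \<le> card P"
      using card_insert_le_m1[of "card P" "P - {x}" y] P(2) xy(1)
      by (auto simp: card_gt_0_iff)
    then have "minimum_cardinality_set ?A ?R"
      using AR fin card_le by (auto simp: minimum_cardinality_set_iff_card_le intro: order_trans)
    then have "sum g P \<le> sum g ?R" using least fin by blast
    also have "\<dots> \<le> g y + sum g (P - {x})"
      using P(2) by (simp add: sum.insert_if)
    also have "\<dots> < g x + sum g (P - {x})"
      using g_less xy one by auto
    also have "\<dots> = sum g P"
      using P(2) xy(1) by (simp add: sum.remove)
    finally show False by simp
  qed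
  \<comment> \<open>Quasi-1-exact sets form a subfamily of the ordinary approximation sets; a
    minimum of the larger family that lies in the subfamily is a minimum there too.\<close>
  moreover have "minimum_cardinality_set ?Q P"
    using QP P(1) quasi_1_exact_imp_approximation_set
    unfolding minimum_cardinality_set_def by blast
  ultimately show ?thesis
    using P unfolding has_minimum_cardinality_def by blast
qed

end
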